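(* Let $\mathbb{X}$ be a finite set and let $(X_t)_{t\ge 0}$ be an irreducible Markov chain on $\mathbb{X}$, in discrete time ($t\in\mathbb{N}$) or in continuous time ($t\in[0,\infty)$), with stationary distribution $\pi$. For $t\geq 0$ let $\pi_t$ be the distribution of $X_t$. Let $$\mathcal{M}=\{x\in\mathbb{X} : \forall t\ge 0,\ \pi_t(x)\le \pi(x)\}.$$ Then $\mathcal{M}$ is a halting set for the total variation distance and the chain $(X_t)_{t\ge 0}$.
   Context: For $A\subset\mathbb{X}$, $T_A$ denotes the hitting time of $A$, $T_A=\inf\{t\ge 0: X_t\in A\}$ (with $\inf\emptyset=+\infty$). The total variation distance to equilibrium is $d(t)=\|\pi_t-\pi\|_{TV}=\sup_{A\subset \mathbb{X}}|\pi_t(A)-\pi(A)|=\frac12\sum_{x\in\mathbb{X}}|\pi_t(x)-\pi(x)|$. A set $A\subset\mathbb{X}$ is a halting set (for the total variation distance and the chain $(X_t)_{t\ge0}$) if $d(t)\le \mathbb{P}(T_A>t)$ for all $t\ge 0$. The initial distribution $\pi_0$ is arbitrary. *)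

theory Defs
  imports "HOL-Probability.Probability"
begin

text \<open>
  The finite state space is a type \<open>'a\<close> of class \<open>finite\<close>. Discrete and continuous time are
  treated together: the time set \<open>\<T>\<close> is a set of reals, either \<open>\<nat>\<close> or \<open>{0..}\<close>.
\<close>

text \<open>
  The kernel \<open>p t x\<close> is the law at time \<open>t\<close> of the chain started at \<open>x\<close>. For \<open>\<T> = \<nat>\<close> these are
  the powers of the transition matrix \<open>p 1\<close>, and the continuity condition is void since \<open>0\<close> is
  isolated; for \<open>\<T> = {0..}\<close> this is a standard transition semigroup.
\<close>

definition transition_semigroup :: "real set \<Rightarrow> (real \<Rightarrow> 'a::finite \<Rightarrow> 'a pmf) \<Rightarrow> bool" where
  "transition_semigroup \<T> p \<longleftrightarrow>
     (\<forall>x. p 0 x = return_pmf x) \<and>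
     (\<forall>s\<in>\<T>. \<forall>t\<in>\<T>. \<forall>x. p (s + t) x = bind_pmf (p s x) (p t)) \<and>
     (\<forall>x y. ((\<lambda>t. pmf (p t x) y) \<longlongrightarrow> pmf (p 0 x) y) (at 0 within \<T>))"

definition irreducible_semigroup :: "real set \<Rightarrow> (real \<Rightarrow> 'a::finite \<Rightarrow> 'a pmf) \<Rightarrow> bool" where
  "irreducible_semigroup \<T> p \<longleftrightarrow> (\<forall>x y. \<exists>t\<in>\<T>. pmf (p t x) y > 0)"

definition stationary :: "real set \<Rightarrow> (real \<Rightarrow> 'a::finite \<Rightarrow> 'a pmf) \<Rightarrow> 'a pmf \<Rightarrow> bool" where
  "stationary \<T> p \<pi> \<longleftrightarrow> (\<forall>t\<in>\<T>. bind_pmf \<pi> (p t) = \<pi>)"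

text \<open>
  Time-homogeneous Markov chain with arbitrary initial law. The last assumption is
  right-continuity of the paths for the discrete topology on the state space; it is void for
  \<open>\<T> = \<nat>\<close>, where the filter is trivial.
\<close>

locale markov_chain = prob_space \<Omega>
  for \<Omega> :: "'w measure" +
  fixes \<T> :: "real set"
    and p :: "real \<Rightarrow> 'a::finite \<Rightarrow> 'a pmf"
    and X :: "real \<Rightarrow> 'w \<Rightarrow> 'a"
  assumes semigroup: "transition_semigroup \<T> p"
    and measurable_X: "t \<in> \<T> \<Longrightarrow> random_variable (count_space UNIV) (X t)"
    and markov_property:
      "\<lbrakk>\<And>i. i \<le> Suc n \<Longrightarrow> \<tau> i \<in> \<T>;
        \<And>i. i \<le> n \<Longrightarrow> \<tau> i < \<tau> (Suc i);
        \<P>(\<omega> in \<Omega>. \<forall>i\<le>n. X (\<tau> i) \<omega> = x i) > 0\<rbrakk>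
       \<Longrightarrow> \<P>(\<omega> in \<Omega>. X (\<tau> (Suc n)) \<omega> = y \<bar> \<forall>i\<le>n. X (\<tau> i) \<omega> = x i)
           = pmf (p (\<tau> (Suc n) - \<tau> n) (x n)) y"
    and right_continuous:
      "\<lbrakk>\<omega> \<in> space \<Omega>; t \<in> \<T>\<rbrakk>
       \<Longrightarrow> eventually (\<lambda>s. X s \<omega> = X t \<omega>) (at t within \<T> \<inter> {t<..})"

definition law_at :: "'w measure \<Rightarrow> (real \<Rightarrow> 'w \<Rightarrow> 'a::finite) \<Rightarrow> real \<Rightarrow> 'a measure" where
  "law_at \<Omega> X t = distr \<Omega> (count_space UNIV) (X t)"

definition tv_dist :: "'a::finite measure \<Rightarrow> 'a measure \<Rightarrow> real" where
  "tv_dist \<mu> \<nu> = (SUP A\<in>UNIV. \<bar>measure \<mu> A - measure \<nu> A\<bar>)"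

text \<open>In \<open>ereal\<close>, the infimum of the empty set is \<open>\<infinity>\<close>.\<close>

definition hitting_time ::
    "real set \<Rightarrow> (real \<Rightarrow> 'w \<Rightarrow> 'a::finite) \<Rightarrow> 'a set \<Rightarrow> 'w \<Rightarrow> ereal" where
  "hitting_time \<T> X A \<omega> = Inf {ereal t | t. t \<in> \<T> \<and> X t \<omega> \<in> A}"

definition halting_set ::
    "'w measure \<Rightarrow> real set \<Rightarrow> (real \<Rightarrow> 'w \<Rightarrow> 'a::finite) \<Rightarrow> 'a pmf \<Rightarrow> 'a set \<Rightarrow> bool" where
  "halting_set \<Omega> \<T> X \<pi> A \<longleftrightarrow>
     (\<forall>t\<in>\<T>. tv_dist (law_at \<Omega> X t) (measure_pmf \<pi>)
              \<le> \<P>(\<omega> in \<Omega>. hitting_time \<T> X A \<omega> > ereal t))"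

end

theory Submission
  imports Defs
begin

text \<open>
  Write \<open>M\<close> for the set of states whose mass never exceeds its equilibrium value. On the event
  that \<open>M\<close> has been visited by time \<open>t\<close>, the law of the chain is dominated by equilibrium:
  \<open>P (X t = x, M visited by time t) \<le> \<pi> x\<close> for every \<open>x\<close>. In discrete time this is an induction
  on \<open>t\<close>. For \<open>x \<in> M\<close> the bound holds even without the restriction on the path, by definition
  of \<open>M\<close>. For \<open>x \<notin> M\<close> the visit must have occurred before the last step, so the left side arises
  by one transition from a measure that is at most \<open>\<pi>\<close> by induction, and transitions preserve
  \<open>\<pi>\<close>. Splitting the event \<open>X t \<in> B\<close> according to whether \<open>M\<close> has been visited then gives
  \<open>P (X t \<in> B) \<le> \<pi> B + P (M not visited by time t)\<close>, which is the claim.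

  The induction only ever looks at finitely many increasing times, so it applies equally to
  continuous time with visits recorded along a finite set of times ending at \<open>t\<close>
  (\<open>law_minus_stationary_le\<close>). Letting these finite sets exhaust the rational times before \<open>t\<close>
  costs nothing: a right-continuous path that visits \<open>M\<close> stays there for a moment, hence a
  visit before \<open>t\<close> is seen at a rational time before \<open>t\<close> (\<open>hitting_time_greater_iff_countable\<close>). Discrete time is the case in
  which all times are rational.
\<close>

section \<open>Total variation distance\<close>

text \<open>
  The absolute value costs nothing, because passing to the complement of the set flips the sign
  of the difference.
\<close>

lemma tv_dist_leI:
  fixes \<mu> \<nu> :: "'a::finite measure"
  assumes "prob_space \<mu>" "prob_space \<nu>" "sets \<mu> = UNIV" "sets \<nu> = UNIV"
    and le: "\<And>B. measure \<mu> B - measure \<nu> B \<le> c"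
  shows "tv_dist \<mu> \<nu> \<le> c"
  unfolding tv_dist_def
proof (rule cSUP_least)
  fix B :: "'a set"
  interpret \<mu>: prob_space \<mu> by fact
  interpret \<nu>: prob_space \<nu> by fact
  have sp: "space \<mu> = UNIV" "space \<nu> = UNIV"
    using assms(3,4) sets.sets_into_space[of UNIV \<mu>] sets.sets_into_space[of UNIV \<nu>] by auto
  have "measure \<mu> (- B) = 1 - measure \<mu> B" "measure \<nu> (- B) = 1 - measure \<nu> B"
    using \<mu>.prob_compl[of B] \<nu>.prob_compl[of B] sp assms(3,4) by (auto simp: Compl_eq_Diff_UNIV)
  then show "\<bar>measure \<mu> B - measure \<nu> B\<bar> \<le> c"
    using le[of B] le[of "- B"] by linarith
qed simp

section \<open>The Markov property along finitely many times\<close>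

context markov_chain
begin

lemma pred_X:
  assumes "t \<in> \<T>"
  shows "Measurable.pred \<Omega> (\<lambda>\<omega>. Q (X t \<omega>))"
  by (rule measurable_compose[OF measurable_X[OF assms]]) simp

lemma events_ex_le:
  fixes n :: nat
  assumes "\<And>i. i \<le> n \<Longrightarrow> \<tau> i \<in> \<T>"
  shows "Measurable.pred \<Omega> (\<lambda>\<omega>. \<exists>i\<le>n. X (\<tau> i) \<omega> \<in> A)"
proof -
  have "Measurable.pred \<Omega> (\<lambda>\<omega>. \<exists>i\<in>{..n}. X (\<tau> i) \<omega> \<in> A)"
    by (intro pred_intros_finite(4) pred_X[where Q = "\<lambda>x. x \<in> A"] assms) simp_all
  then show ?thesis unfolding Bex_def atMost_iff .
qed

lemma events_all_le:
  fixes n :: nat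
  assumes "\<And>i. i \<le> n \<Longrightarrow> \<tau> i \<in> \<T>"
  shows "Measurable.pred \<Omega> (\<lambda>\<omega>. \<forall>i\<le>n. X (\<tau> i) \<omega> = g i)"
proof -
  have "Measurable.pred \<Omega> (\<lambda>\<omega>. \<forall>i\<in>{..n}. X (\<tau> i) \<omega> = g i)"
  proof (rule pred_intros_finite(3))
    fix i assume "i \<in> {..n}"
    then show "Measurable.pred \<Omega> (\<lambda>\<omega>. X (\<tau> i) \<omega> = g i)"
      by (intro pred_X[where Q = "\<lambda>x. x = g i"] assms) simp
  qed simp
  then show ?thesis unfolding Ball_def atMost_iff .
qed

lemma prob_path_step:
  assumes "\<And>i. i \<le> Suc n \<Longrightarrow> \<tau> i \<in> \<T>" "\<And>i. i \<le> n \<Longrightarrow> \<tau> i < \<tau> (Suc i)"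
  shows "\<P>(\<omega> in \<Omega>. X (\<tau> (Suc n)) \<omega> = y \<and> (\<forall>i\<le>n. X (\<tau> i) \<omega> = g i))
    = \<P>(\<omega> in \<Omega>. \<forall>i\<le>n. X (\<tau> i) \<omega> = g i) * pmf (p (\<tau> (Suc n) - \<tau> n) (g n)) y"
    (is "?L = ?P * ?q")
proof (cases "?P > 0")
  case True
  then show ?thesis
    using markov_property[where n = n and \<tau> = \<tau> and x = g and y = y, OF assms True]
    by (simp add: cond_prob_def field_simps)
next
  case False
  moreover have "?P \<ge> 0" by simp
  ultimately have "?P = 0" by linarith
  moreover have "?L \<le> ?P"
    by (intro finite_measure_mono predE[OF events_all_le] assms(1)) auto
  moreover have "?L \<ge> 0" by simp
  ultimately show ?thesis by (simp only: mult_zero_left)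
qed

text \<open>
  Conditioning on a full path is strengthened to conditioning on the present state together with
  an event about the past, by summing over the finitely many paths that make up that event.
\<close>

lemma prob_step_after_visit:
  assumes \<tau>: "\<And>i. i \<le> Suc n \<Longrightarrow> \<tau> i \<in> \<T>" "\<And>i. i \<le> n \<Longrightarrow> \<tau> i < \<tau> (Suc i)"
  shows "\<P>(\<omega> in \<Omega>. X (\<tau> (Suc n)) \<omega> = y \<and> X (\<tau> n) \<omega> = z \<and> (\<exists>i\<le>n. X (\<tau> i) \<omega> \<in> A))
    = \<P>(\<omega> in \<Omega>. X (\<tau> n) \<omega> = z \<and> (\<exists>i\<le>n. X (\<tau> i) \<omega> \<in> A)) * pmf (p (\<tau> (Suc n) - \<tau> n) z) y"
proof -
  define G where "G = {g \<in> {..n} \<rightarrow>\<^sub>E (UNIV :: 'a set). g n = z \<and> (\<exists>i\<le>n. g i \<in> A)}"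
  have fin: "finite G"
    unfolding G_def by (rule finite_subset[OF _ finite_PiE[of "{..n}" "\<lambda>_. UNIV"]]) auto
  have sum_paths: "\<P>(\<omega> in \<Omega>. R \<omega> \<and> X (\<tau> n) \<omega> = z \<and> (\<exists>i\<le>n. X (\<tau> i) \<omega> \<in> A))
      = (\<Sum>g\<in>G. \<P>(\<omega> in \<Omega>. R \<omega> \<and> (\<forall>i\<le>n. X (\<tau> i) \<omega> = g i)))"
    if R: "Measurable.pred \<Omega> R" for R
  proof -
    have path: "\<exists>g\<in>G. \<forall>i\<le>n. X (\<tau> i) \<omega> = g i"
      if "X (\<tau> n) \<omega> = z" "i \<le> n" "X (\<tau> i) \<omega> \<in> A" for \<omega> i
      using that by (intro bexI[of _ "restrict (\<lambda>i. X (\<tau> i) \<omega>) {..n}"]) (auto simp: G_def)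
    have "{\<omega> \<in> space \<Omega>. R \<omega> \<and> X (\<tau> n) \<omega> = z \<and> (\<exists>i\<le>n. X (\<tau> i) \<omega> \<in> A)}
        = (\<Union>g\<in>G. {\<omega> \<in> space \<Omega>. R \<omega> \<and> (\<forall>i\<le>n. X (\<tau> i) \<omega> = g i)})"
      (is "?L = ?R")
    proof
      show "?L \<subseteq> ?R" using path by blast
      show "?R \<subseteq> ?L" by (force simp: G_def)
    qed
    moreover have "disjoint_family_on (\<lambda>g. {\<omega> \<in> space \<Omega>. R \<omega> \<and> (\<forall>i\<le>n. X (\<tau> i) \<omega> = g i)}) G"
      unfolding disjoint_family_on_def
    proof safe
      fix g h \<omega> assume gh: "g \<in> G" "h \<in> G" "g \<noteq> h"
        and eq: "\<forall>i\<le>n. X (\<tau> i) \<omega> = g i" "\<forall>i\<le>n. X (\<tau> i) \<omega> = h i"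
      have "g = h"
        using gh eq by (intro PiE_ext[of g "{..n}" "\<lambda>_. UNIV" h]) (auto simp: G_def)
      with gh show "\<omega> \<in> {}" by simp
    qed
    moreover have "{\<omega> \<in> space \<Omega>. R \<omega> \<and> (\<forall>i\<le>n. X (\<tau> i) \<omega> = g i)} \<in> events" for g
      unfolding pred_def[symmetric]
      by (intro pred_intros_logic(3) R events_all_le \<tau>(1)) simp
    ultimately show ?thesis
      using fin by (simp add: finite_measure_finite_Union image_subset_iff)
  qed
  have "Measurable.pred \<Omega> (\<lambda>\<omega>. X (\<tau> (Suc n)) \<omega> = y)"
    by (rule pred_X[where Q = "\<lambda>x. x = y"]) (simp add: \<tau>)
  note sum_paths[OF this]
  also have "(\<Sum>g\<in>G. \<P>(\<omega> in \<Omega>. X (\<tau> (Suc n)) \<omega> = y \<and> (\<forall>i\<le>n. X (\<tau> i) \<omega> = g i)))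
      = (\<Sum>g\<in>G. \<P>(\<omega> in \<Omega>. \<forall>i\<le>n. X (\<tau> i) \<omega> = g i)) * pmf (p (\<tau> (Suc n) - \<tau> n) z) y"
    unfolding sum_distrib_right
  proof (rule sum.cong)
    fix g assume "g \<in> G"
    then have "g n = z" by (simp add: G_def)
    then show "\<P>(\<omega> in \<Omega>. X (\<tau> (Suc n)) \<omega> = y \<and> (\<forall>i\<le>n. X (\<tau> i) \<omega> = g i))
        = \<P>(\<omega> in \<Omega>. \<forall>i\<le>n. X (\<tau> i) \<omega> = g i) * pmf (p (\<tau> (Suc n) - \<tau> n) z) y"
      using prob_path_step[of n \<tau> y g, OF \<tau>] by simp
  qed simp
  also have "(\<Sum>g\<in>G. \<P>(\<omega> in \<Omega>. \<forall>i\<le>n. X (\<tau> i) \<omega> = g i))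
      = \<P>(\<omega> in \<Omega>. X (\<tau> n) \<omega> = z \<and> (\<exists>i\<le>n. X (\<tau> i) \<omega> \<in> A))"
    using sum_paths[of "\<lambda>_. True"] by simp
  finally show ?thesis .
qed

section \<open>Domination by equilibrium after a visit\<close>

text \<open>
  The induction runs over the sub-probability \<open>\<nu>\<^sub>N\<close> of being at a given state after a visit to
  \<open>A\<close>. Outside \<open>A\<close> it satisfies \<open>\<nu>\<^sub>N\<^sub>+\<^sub>1 = \<nu>\<^sub>N P\<close> and inherits the bound from \<open>\<pi> P = \<pi>\<close>; on \<open>A\<close>
  it gains the newly arriving mass, and there the bound on the law itself takes over.
\<close>

lemma prob_after_visit_le_stationary:
  fixes N :: nat
  assumes diff: "\<And>s t. s \<in> \<T> \<Longrightarrow> t \<in> \<T> \<Longrightarrow> s \<le> t \<Longrightarrow> t - s \<in> \<T>"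
    and stat: "stationary \<T> p \<pi>"
    and A: "\<And>s x. s \<in> \<T> \<Longrightarrow> x \<in> A \<Longrightarrow> \<P>(\<omega> in \<Omega>. X s \<omega> = x) \<le> pmf \<pi> x"
    and "\<And>i. i \<le> N \<Longrightarrow> \<tau> i \<in> \<T>" "\<And>i. i < N \<Longrightarrow> \<tau> i < \<tau> (Suc i)"
  shows "\<P>(\<omega> in \<Omega>. X (\<tau> N) \<omega> = x \<and> (\<exists>i\<le>N. X (\<tau> i) \<omega> \<in> A)) \<le> pmf \<pi> x"
  using assms(4,5)
proof (induction N arbitrary: x)
  case 0
  show ?case
  proof (cases "x \<in> A")
    case True
    then have "{\<omega> \<in> space \<Omega>. X (\<tau> 0) \<omega> = x \<and> (\<exists>i\<le>0. X (\<tau> i) \<omega> \<in> A)}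
        = {\<omega> \<in> space \<Omega>. X (\<tau> 0) \<omega> = x}"
      by auto
    with A[OF 0(1) True, of 0] show ?thesis by simp
  next
    case False
    then have "{\<omega> \<in> space \<Omega>. X (\<tau> 0) \<omega> = x \<and> (\<exists>i\<le>0. X (\<tau> i) \<omega> \<in> A)} = {}"
      by auto
    then show ?thesis by (simp only: measure_empty pmf_nonneg)
  qed
next
  case (Suc n)
  have \<tau>: "\<And>i. i \<le> Suc n \<Longrightarrow> \<tau> i \<in> \<T>" "\<And>i. i \<le> n \<Longrightarrow> \<tau> i < \<tau> (Suc i)"
    using Suc.prems by auto
  have IH: "\<P>(\<omega> in \<Omega>. X (\<tau> n) \<omega> = z \<and> (\<exists>i\<le>n. X (\<tau> i) \<omega> \<in> A)) \<le> pmf \<pi> z" for z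
    by (rule Suc.IH) (use Suc.prems in auto)
  let ?E = "{\<omega> \<in> space \<Omega>. X (\<tau> (Suc n)) \<omega> = x \<and> (\<exists>i\<le>Suc n. X (\<tau> i) \<omega> \<in> A)}"
  let ?F = "\<lambda>z. {\<omega> \<in> space \<Omega>. X (\<tau> (Suc n)) \<omega> = x \<and> X (\<tau> n) \<omega> = z \<and> (\<exists>i\<le>n. X (\<tau> i) \<omega> \<in> A)}"
  define d where "d = \<tau> (Suc n) - \<tau> n"
  have state: "Measurable.pred \<Omega> (\<lambda>\<omega>. X (\<tau> i) \<omega> = w)" if "i \<le> Suc n" for i w
    by (rule pred_X[where Q = "\<lambda>x. x = w"]) (simp add: \<tau> that)
  show ?case
  proof (cases "x \<in> A")
    case True
    have "prob ?E \<le> \<P>(\<omega> in \<Omega>. X (\<tau> (Suc n)) \<omega> = x)"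
      by (intro finite_measure_mono predE[OF state]) auto
    also have "\<dots> \<le> pmf \<pi> x" using A \<tau>(1) True by simp
    finally show ?thesis .
  next
    case False
    \<comment> \<open>the visit to \<open>A\<close> precedes the last step, which ends in \<open>x \<notin> A\<close>\<close>
    have F: "?F z \<in> events" for z
      unfolding pred_def[symmetric]
      by (intro pred_intros_logic(3) state events_ex_le \<tau>(1)) simp_all
    have "?E = (\<Union>z. ?F z)"
      using False by (auto simp: le_Suc_eq)
    then have "prob ?E = (\<Sum>z\<in>UNIV. prob (?F z))"
      using F by (auto intro!: finite_measure_finite_Union simp: disjoint_family_on_def)
    also have "\<dots> = (\<Sum>z\<in>UNIV. \<P>(\<omega> in \<Omega>. X (\<tau> n) \<omega> = z \<and> (\<exists>i\<le>n. X (\<tau> i) \<omega> \<in> A)) * pmf (p d z) x)"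
      unfolding d_def by (intro sum.cong refl prob_step_after_visit \<tau>)
    also have "\<dots> \<le> (\<Sum>z\<in>UNIV. pmf \<pi> z * pmf (p d z) x)"
      by (intro sum_mono mult_right_mono IH) simp
    also have "\<dots> = pmf (bind_pmf \<pi> (p d)) x"
      by (simp add: pmf_bind integral_measure_pmf[of UNIV])
    also have "\<dots> = pmf \<pi> x"
    proof -
      have "d \<in> \<T>" unfolding d_def using \<tau>(2)[of n] by (intro diff \<tau>(1)) auto
      then show ?thesis using stat by (simp add: stationary_def)
    qed
    finally show ?thesis .
  qed
qed

text \<open>
  Only paths that avoid \<open>A\<close> can contribute an excess over equilibrium: those that have visited
  \<open>A\<close> put at most \<open>\<pi> x\<close> on each \<open>x \<in> B\<close>.
\<close>

lemma law_minus_stationary_le: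
  assumes diff: "\<And>s t. s \<in> \<T> \<Longrightarrow> t \<in> \<T> \<Longrightarrow> s \<le> t \<Longrightarrow> t - s \<in> \<T>"
    and stat: "stationary \<T> p \<pi>"
    and A: "\<And>s x. s \<in> \<T> \<Longrightarrow> x \<in> A \<Longrightarrow> \<P>(\<omega> in \<Omega>. X s \<omega> = x) \<le> pmf \<pi> x"
    and F: "finite F" "F \<subseteq> \<T>" "t \<in> F" "\<And>s. s \<in> F \<Longrightarrow> s \<le> t"
  shows "\<P>(\<omega> in \<Omega>. X t \<omega> \<in> B) - measure \<pi> B \<le> \<P>(\<omega> in \<Omega>. \<forall>s\<in>F. X s \<omega> \<notin> A)"
proof -
  define xs where "xs = sorted_list_of_set F"
  define N where "N = length xs - 1"
  have xs: "set xs = F" "sorted_wrt (<) xs"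
    using F(1) by (simp_all add: xs_def)
  have len: "length xs = Suc N"
    using xs(1) F(3) by (cases xs) (auto simp: N_def)
  have range: "F = (\<lambda>i. xs ! i) ` {..N}"
    unfolding xs(1)[symmetric] by (force simp: len in_set_conv_nth less_Suc_eq_le)
  have last: "xs ! N = t"
  proof (rule antisym)
    show "xs ! N \<le> t" using range F(4) by auto
    obtain i where "i \<le> N" "xs ! i = t" using F(3) range by auto
    then show "t \<le> xs ! N"
      using sorted_wrt_nth_less[OF xs(2), of i N] len by (cases "i = N") auto
  qed
  have visited: "\<P>(\<omega> in \<Omega>. X t \<omega> = x \<and> (\<exists>s\<in>F. X s \<omega> \<in> A)) \<le> pmf \<pi> x" for x
  proof -
    have "\<P>(\<omega> in \<Omega>. X (xs ! N) \<omega> = x \<and> (\<exists>i\<le>N. X (xs ! i) \<omega> \<in> A)) \<le> pmf \<pi> x"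
      using range F(2) sorted_wrt_nth_less[OF xs(2)] len
      by (intro prob_after_visit_le_stationary[OF diff stat A]) auto
    then show ?thesis by (simp add: last range Bex_def)
  qed
  have meas: "Measurable.pred \<Omega> (\<lambda>\<omega>. X s \<omega> \<in> C)" if "s \<in> F" for s C
    using that F(2) by (intro pred_X[where Q = "\<lambda>x. x \<in> C"]) auto
  have ex: "Measurable.pred \<Omega> (\<lambda>\<omega>. \<exists>s\<in>F. X s \<omega> \<in> A)"
    by (intro pred_intros_finite(4) F(1) meas)
  have all: "Measurable.pred \<Omega> (\<lambda>\<omega>. \<forall>s\<in>F. X s \<omega> \<notin> A)"
    by (intro pred_intros_finite(3) F(1) pred_intros_logic(2) meas)
  let ?V = "\<lambda>x. {\<omega> \<in> space \<Omega>. X t \<omega> = x \<and> (\<exists>s\<in>F. X s \<omega> \<in> A)}"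
  have V: "?V x \<in> events" for x
    using meas[OF F(3), of "{x}"]
    unfolding pred_def[symmetric] by (intro pred_intros_logic(3) ex) simp
  have "\<P>(\<omega> in \<Omega>. X t \<omega> \<in> B) \<le> prob ((\<Union>x\<in>B. ?V x) \<union> {\<omega> \<in> space \<Omega>. \<forall>s\<in>F. X s \<omega> \<notin> A})"
    using V by (intro finite_measure_mono sets.Un sets.finite_UN) (use predE[OF all] in auto)
  also have "\<dots> \<le> prob (\<Union>x\<in>B. ?V x) + \<P>(\<omega> in \<Omega>. \<forall>s\<in>F. X s \<omega> \<notin> A)"
    using V by (intro measure_Un_le sets.finite_UN) (use predE[OF all] in auto)
  also have "prob (\<Union>x\<in>B. ?V x) \<le> (\<Sum>x\<in>B. prob (?V x))"
    using V by (intro finite_measure_subadditive_finite) auto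
  also have "\<dots> \<le> (\<Sum>x\<in>B. pmf \<pi> x)"
    by (intro sum_mono visited)
  also have "\<dots> = measure \<pi> B"
    by (simp add: measure_measure_pmf_finite)
  finally show ?thesis by simp
qed

section \<open>Observing the hitting time at countably many times\<close>

text \<open>
  No visit by time \<open>t\<close> forces the infimum to lie strictly above \<open>t\<close>: if the chain is outside \<open>A\<close> at time \<open>t\<close>,
  right-continuity keeps it outside for a while, so later visits cannot accumulate at \<open>t\<close>.
\<close>

lemma hitting_time_greater_iff:
  assumes "\<omega> \<in> space \<Omega>" "t \<in> \<T>"
  shows "hitting_time \<T> X A \<omega> > ereal t \<longleftrightarrow> (\<forall>s\<in>\<T>. s \<le> t \<longrightarrow> X s \<omega> \<notin> A)"
proof
  assume gt: "hitting_time \<T> X A \<omega> > ereal t"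
  show "\<forall>s\<in>\<T>. s \<le> t \<longrightarrow> X s \<omega> \<notin> A"
  proof (intro ballI impI notI)
    fix s assume "s \<in> \<T>" "s \<le> t" "X s \<omega> \<in> A"
    then have "hitting_time \<T> X A \<omega> \<le> ereal s"
      unfolding hitting_time_def by (intro Inf_lower) auto
    also have "\<dots> \<le> ereal t" using \<open>s \<le> t\<close> by simp
    finally show False using gt by simp
  qed
next
  assume no: "\<forall>s\<in>\<T>. s \<le> t \<longrightarrow> X s \<omega> \<notin> A"
  obtain e where e: "e > 0" "\<And>s. s \<in> \<T> \<Longrightarrow> t < s \<Longrightarrow> s < t + e \<Longrightarrow> X s \<omega> = X t \<omega>"
    using right_continuous[OF assms] by (fastforce simp: eventually_at dist_real_def)
  have "ereal (t + e) \<le> hitting_time \<T> X A \<omega>"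
    unfolding hitting_time_def
  proof (rule Inf_greatest, safe)
    fix s assume "s \<in> \<T>" "X s \<omega> \<in> A"
    then show "ereal (t + e) \<le> ereal s"
      using no e(2)[of s] assms(2) by (cases "s \<le> t"; cases "s < t + e") auto
  qed
  moreover have "ereal t < ereal (t + e)" using e(1) by simp
  ultimately show "hitting_time \<T> X A \<omega> > ereal t" by (rule less_le_trans[rotated])
qed

lemma hitting_time_greater_iff_countable:
  assumes \<T>: "\<T> = \<nat> \<or> \<T> = {0..}" and \<omega>: "\<omega> \<in> space \<Omega>" and t: "t \<in> \<T>"
  shows "hitting_time \<T> X A \<omega> > ereal t \<longleftrightarrow> (\<forall>s\<in>insert t (\<T> \<inter> \<rat> \<inter> {..t}). X s \<omega> \<notin> A)"
proof -
  have "\<exists>r\<in>insert t (\<T> \<inter> \<rat> \<inter> {..t}). X r \<omega> \<in> A" if s: "s \<in> \<T>" "s \<le> t" "X s \<omega> \<in> A" for s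
  proof (cases "s \<in> \<rat> \<or> s = t")
    case True
    with s show ?thesis by blast
  next
    case False
    then have "\<T> = {0..}" and "s < t" using \<T> s Nats_subset_Rats by auto
    obtain e where e: "e > 0" "\<And>r. r \<in> \<T> \<Longrightarrow> s < r \<Longrightarrow> r < s + e \<Longrightarrow> X r \<omega> = X s \<omega>"
      using right_continuous[OF \<omega> s(1)] by (fastforce simp: eventually_at dist_real_def)
    obtain r where r: "r \<in> \<rat>" "s < r" "r < min t (s + e)"
      using Rats_dense_in_real[of s "min t (s + e)"] \<open>s < t\<close> e(1) by auto
    then have "r \<in> \<T>" using s(1) \<open>\<T> = {0..}\<close> by auto
    then show ?thesis using r e(2)[of r] s(3) by (intro bexI[of _ r]) auto
  qed
  then show ?thesis
    using t by (subst hitting_time_greater_iff[OF \<omega> t]) blast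
qed

text \<open>
  Exhausting a countable set of times by finite sets turns avoidance at all those times into a
  decreasing intersection, so a bound for finite sets passes to the limit.
\<close>

lemma le_prob_avoid_countable:
  assumes D: "countable D" "D \<subseteq> \<T>" "t \<in> D"
    and le: "\<And>F. finite F \<Longrightarrow> F \<subseteq> D \<Longrightarrow> t \<in> F \<Longrightarrow> c \<le> \<P>(\<omega> in \<Omega>. \<forall>s\<in>F. X s \<omega> \<notin> A)"
  shows "c \<le> \<P>(\<omega> in \<Omega>. \<forall>s\<in>D. X s \<omega> \<notin> A)"
proof -
  define F where "F n = insert t (from_nat_into D ` {..n})" for n :: nat
  define E where "E n = {\<omega> \<in> space \<Omega>. \<forall>s\<in>F n. X s \<omega> \<notin> A}" for n
  have FD: "F n \<subseteq> D" for n
    using D(3) from_nat_into[of D] by (auto simp: F_def)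
  have "D \<subseteq> (\<Union>n. F n)"
  proof
    fix s assume "s \<in> D"
    then obtain n where "from_nat_into D n = s"
      using from_nat_into_surj[OF D(1)] by blast
    then show "s \<in> (\<Union>n. F n)" by (auto simp: F_def)
  qed
  with FD have D_eq: "D = (\<Union>n. F n)" by blast
  have "E n \<in> events" for n
  proof -
    have "Measurable.pred \<Omega> (\<lambda>\<omega>. \<forall>s\<in>F n. X s \<omega> \<notin> A)"
    proof (rule pred_intros_finite(3))
      show "finite (F n)" by (simp add: F_def)
      fix s assume "s \<in> F n"
      then have "s \<in> \<T>" using FD D(2) by blast
      then show "Measurable.pred \<Omega> (\<lambda>\<omega>. X s \<omega> \<notin> A)" by (rule pred_X)
    qed
    then show ?thesis unfolding E_def by (rule predE)
  qed
  moreover have "decseq E"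
    by (rule decseq_SucI) (auto simp: E_def F_def atMost_Suc)
  ultimately have "(\<lambda>n. prob (E n)) \<longlonglongrightarrow> prob (\<Inter>n. E n)"
    by (intro finite_Lim_measure_decseq) auto
  moreover have "c \<le> prob (E n)" for n
    unfolding E_def by (rule le) (use FD in \<open>auto simp: F_def\<close>)
  ultimately have "c \<le> prob (\<Inter>n. E n)"
    by (intro LIMSEQ_le_const) auto
  also have "(\<Inter>n. E n) = {\<omega> \<in> space \<Omega>. \<forall>s\<in>D. X s \<omega> \<notin> A}"
    by (auto simp: E_def D_eq)
  finally show ?thesis .
qed

lemma measure_law_at:
  assumes "t \<in> \<T>"
  shows "measure (law_at \<Omega> X t) B = \<P>(\<omega> in \<Omega>. X t \<omega> \<in> B)"
  unfolding law_at_def using measurable_X[OF assms]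
  by (subst measure_distr) (auto intro!: arg_cong[where f = prob])

end

section \<open>The halting set\<close>

theorem theorem1p2:
  fixes \<Omega> :: "'w measure"
    and \<T> :: "real set"
    and p :: "real \<Rightarrow> 'a::finite \<Rightarrow> 'a pmf"
    and X :: "real \<Rightarrow> 'w \<Rightarrow> 'a"
    and \<pi> :: "'a pmf"
  assumes "\<T> = \<nat> \<or> \<T> = {0..}"
    and "markov_chain \<Omega> \<T> p X"
    and "irreducible_semigroup \<T> p"
    and "stationary \<T> p \<pi>"
  shows "halting_set \<Omega> \<T> X \<pi> {x. \<forall>t\<in>\<T>. measure (law_at \<Omega> X t) {x} \<le> pmf \<pi> x}"
  unfolding halting_set_def
proof
  interpret markov_chain \<Omega> \<T> p X by fact
  define M where "M = {x. \<forall>t\<in>\<T>. measure (law_at \<Omega> X t) {x} \<le> pmf \<pi> x}"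
  have M: "\<P>(\<omega> in \<Omega>. X s \<omega> = x) \<le> pmf \<pi> x" if "s \<in> \<T>" "x \<in> M" for s x
  proof -
    have "measure (law_at \<Omega> X s) {x} \<le> pmf \<pi> x" using that by (simp add: M_def)
    then show ?thesis using measure_law_at[OF that(1), of "{x}"] by simp
  qed
  have diff: "t - s \<in> \<T>" if "s \<in> \<T>" "t \<in> \<T>" "s \<le> t" for s t
    using assms(1) that
    by (auto simp: Nats_def simp flip: of_nat_diff)
  fix t assume t: "t \<in> \<T>"
  \<comment> \<open>\<open>t\<close> is listed separately because a path may enter the set only at the possibly irrational time \<open>t\<close>\<close>
  let ?D = "insert t (\<T> \<inter> \<rat> \<inter> {..t})"
  have "measure (law_at \<Omega> X t) B - measure \<pi> B \<le> \<P>(\<omega> in \<Omega>. hitting_time \<T> X M \<omega> > ereal t)" for B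
  proof -
    have "measure (law_at \<Omega> X t) B - measure \<pi> B \<le> \<P>(\<omega> in \<Omega>. \<forall>s\<in>?D. X s \<omega> \<notin> M)"
      unfolding measure_law_at[OF t]
    proof (rule le_prob_avoid_countable)
      show "countable ?D"
        using countable_rat by (auto intro: countable_subset[of _ \<rat>])
      show "?D \<subseteq> \<T>" using t by auto
      fix F assume F: "finite F" "F \<subseteq> ?D" "t \<in> F"
      show "\<P>(\<omega> in \<Omega>. X t \<omega> \<in> B) - measure \<pi> B \<le> \<P>(\<omega> in \<Omega>. \<forall>s\<in>F. X s \<omega> \<notin> M)"
        by (rule law_minus_stationary_le[OF diff assms(4) M]) (use F t in auto)
    qed simp
    also have "{\<omega> \<in> space \<Omega>. \<forall>s\<in>?D. X s \<omega> \<notin> M} = {\<omega> \<in> space \<Omega>. hitting_time \<T> X M \<omega> > ereal t}"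
      using hitting_time_greater_iff_countable[OF assms(1) _ t] by blast
    finally show ?thesis .
  qed
  then have "tv_dist (law_at \<Omega> X t) (measure_pmf \<pi>) \<le> \<P>(\<omega> in \<Omega>. hitting_time \<T> X M \<omega> > ereal t)"
    using measurable_X[OF t]
    by (intro tv_dist_leI) (auto simp: law_at_def prob_space_distr measure_pmf.prob_space_axioms)
  then show "tv_dist (law_at \<Omega> X t) (measure_pmf \<pi>)
      \<le> \<P>(\<omega> in \<Omega>. hitting_time \<T> X {x. \<forall>t\<in>\<T>. measure (law_at \<Omega> X t) {x} \<le> pmf \<pi> x} \<omega> > ereal t)"
    by (simp only: M_def)
qed

end
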